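(* Let $(D,\dashv,\vdash,\alpha,\beta)$ be a BiHom-associative dialgebra, let $k,l$ be non-negative integers, and let $\theta:D\to D$ be an injective averaging operator on $D$, i.e. $\theta$ is an injective linear map such that $\alpha\circ\theta=\theta\circ\alpha$, $\beta\circ\theta=\theta\circ\beta$, and for all $x,y\in D$ $$\theta(x)\dashv\theta(y)=\theta(\alpha^k\beta^l(x)\dashv\theta(y))=\theta(\theta(x)\dashv\alpha^k\beta^l(y)),$$ $$\theta(x)\vdash\theta(y)=\theta(\alpha^k\beta^l(x)\vdash\theta(y))=\theta(\theta(x)\vdash\alpha^k\beta^l(y)).$$ Then $(D,\triangleleft,\triangleright,\alpha,\beta)$ is a BiHom-associative dialgebra, where for all $x,y\in D$ $$x\triangleleft y=\theta(x)\dashv\alpha^k\beta^l(y),\qquad x\triangleright y=\alpha^k\beta^l(x)\vdash\theta(y).$$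
   Context: All vector spaces are over a fixed field. A BiHom-associative dialgebra is a tuple $(A,\dashv,\vdash,\alpha,\beta)$ consisting of a vector space $A$, bilinear maps $\dashv,\vdash:A\times A\to A$ and linear maps $\alpha,\beta:A\to A$ such that $\alpha\circ\beta=\beta\circ\alpha$ and, for all $x,y,z\in A$: (i) $(x\dashv y)\dashv\beta(z)=\alpha(x)\dashv(y\dashv z)$; (ii) $(x\dashv y)\dashv\beta(z)=\alpha(x)\dashv(y\vdash z)$; (iii) $(x\vdash y)\dashv\beta(z)=\alpha(x)\vdash(y\dashv z)$; (iv) $(x\dashv y)\vdash\beta(z)=\alpha(x)\vdash(y\vdash z)$; (v) $(x\vdash y)\vdash\beta(z)=\alpha(x)\vdash(y\vdash z)$. $\alpha^k\beta^l$ denotes the composite of the $k$-fold iterate of $\alpha$ and the $l$-fold iterate of $\beta$. *)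

theory Defs
  imports Complex_Main
begin

text \<open>
  The base field is the type \<open>'k\<close>, the vector space the type \<open>'v\<close> with scalar multiplication
  \<open>scale\<close>. The structure maps \<open>\<alpha>\<close> and \<open>\<beta>\<close> are only required to be
  commuting linear maps: they need neither be bijective nor respect the two products.
\<close>

definition bilinear_op ::
    "('k::field \<Rightarrow> 'v::ab_group_add \<Rightarrow> 'v) \<Rightarrow> ('v \<Rightarrow> 'v \<Rightarrow> 'v) \<Rightarrow> bool" where
  "bilinear_op scale m \<longleftrightarrow>
     (\<forall>x. Vector_Spaces.linear scale scale (\<lambda>y. m x y)) \<and>
     (\<forall>y. Vector_Spaces.linear scale scale (\<lambda>x. m x y))"

locale bihom_assoc_dialgebra = vector_space scale
  for scale :: "'k::field \<Rightarrow> 'v::ab_group_add \<Rightarrow> 'v"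
    and left_prod :: "'v \<Rightarrow> 'v \<Rightarrow> 'v"  (infixl \<open>\<stileturn>\<close> 70)
    and right_prod :: "'v \<Rightarrow> 'v \<Rightarrow> 'v"  (infixl \<open>\<turnstile>\<close> 70)
    and \<alpha> :: "'v \<Rightarrow> 'v"
    and \<beta> :: "'v \<Rightarrow> 'v" +
  assumes bilinear_left: "bilinear_op scale (\<stileturn>)"
    and bilinear_right: "bilinear_op scale (\<turnstile>)"
    and linear_alpha: "Vector_Spaces.linear scale scale \<alpha>"
    and linear_beta: "Vector_Spaces.linear scale scale \<beta>"
    and alpha_beta_commute: "\<alpha> \<circ> \<beta> = \<beta> \<circ> \<alpha>"
    and left_left: "(x \<stileturn> y) \<stileturn> \<beta> z = \<alpha> x \<stileturn> (y \<stileturn> z)"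
    and left_left_right: "(x \<stileturn> y) \<stileturn> \<beta> z = \<alpha> x \<stileturn> (y \<turnstile> z)"
    and right_left: "(x \<turnstile> y) \<stileturn> \<beta> z = \<alpha> x \<turnstile> (y \<stileturn> z)"
    and left_right_right: "(x \<stileturn> y) \<turnstile> \<beta> z = \<alpha> x \<turnstile> (y \<turnstile> z)"
    and right_right: "(x \<turnstile> y) \<turnstile> \<beta> z = \<alpha> x \<turnstile> (y \<turnstile> z)"

definition twist_pow :: "('v \<Rightarrow> 'v) \<Rightarrow> ('v \<Rightarrow> 'v) \<Rightarrow> nat \<Rightarrow> nat \<Rightarrow> 'v \<Rightarrow> 'v" where
  "twist_pow \<alpha> \<beta> k l = (\<alpha> ^^ k) \<circ> (\<beta> ^^ l)"

locale averaging_operator =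
  bihom_assoc_dialgebra scale left_prod right_prod \<alpha> \<beta>
  for scale :: "'k::field \<Rightarrow> 'v::ab_group_add \<Rightarrow> 'v"
    and left_prod :: "'v \<Rightarrow> 'v \<Rightarrow> 'v"  (infixl \<open>\<stileturn>\<close> 70)
    and right_prod :: "'v \<Rightarrow> 'v \<Rightarrow> 'v"  (infixl \<open>\<turnstile>\<close> 70)
    and \<alpha> :: "'v \<Rightarrow> 'v"
    and \<beta> :: "'v \<Rightarrow> 'v" +
  fixes k l :: nat
    and \<theta> :: "'v \<Rightarrow> 'v"
  assumes linear_theta: "Vector_Spaces.linear scale scale \<theta>"
    and alpha_theta_commute: "\<alpha> \<circ> \<theta> = \<theta> \<circ> \<alpha>"
    and beta_theta_commute: "\<beta> \<circ> \<theta> = \<theta> \<circ> \<beta>"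
    and averaging_left1: "\<theta> x \<stileturn> \<theta> y = \<theta> (twist_pow \<alpha> \<beta> k l x \<stileturn> \<theta> y)"
    and averaging_left2: "\<theta> x \<stileturn> \<theta> y = \<theta> (\<theta> x \<stileturn> twist_pow \<alpha> \<beta> k l y)"
    and averaging_right1: "\<theta> x \<turnstile> \<theta> y = \<theta> (twist_pow \<alpha> \<beta> k l x \<turnstile> \<theta> y)"
    and averaging_right2: "\<theta> x \<turnstile> \<theta> y = \<theta> (\<theta> x \<turnstile> twist_pow \<alpha> \<beta> k l y)"

end

theory Submission
  imports Defs
begin

text \<open>
  The averaging identities say that \<open>\<theta>\<close> is a homomorphism from the new products to the old ones:
  \<open>\<theta> (x \<triangleleft> y) = \<theta> x \<stileturn> \<theta> y\<close> and \<open>\<theta> (x \<triangleright> y) = \<theta> x \<turnstile> \<theta> y\<close>. As \<open>\<theta>\<close> also commutes with the structure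
  maps, applying it to any dialgebra identity for the new products yields the same
  identity for the old products, evaluated at images under \<open>\<theta>\<close>; injectivity then cancels \<open>\<theta>\<close>.
  The same argument gives bilinearity of the new products, so nothing has to be known about
  the twist \<open>\<alpha>\<^sup>k\<beta>\<^sup>l\<close>, not even its linearity. The transfer is
  \<open>bihom_assoc_dialgebra_pullback\<close> below.
\<close>

lemma bilinear_op_pullback:
  assumes m: "bilinear_op scale m"
    and f: "Vector_Spaces.linear scale scale f" "inj f"
    and hom: "\<And>x y. f (m' x y) = m (f x) (f y)"
  shows "bilinear_op scale m'"
proof -
  interpret f: Vector_Spaces.linear scale scale f by (fact f(1))
  have left: "Vector_Spaces.linear scale scale (\<lambda>y. m x y)"
    and right: "Vector_Spaces.linear scale scale (\<lambda>x. m x y)" for x y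
    using m by (auto simp: bilinear_op_def)
  have linearI: "Vector_Spaces.linear scale scale g"
    if "\<And>x y. g (x + y) = g x + g y" "\<And>c x. g (scale c x) = scale c (g x)" for g
    using that f(1) by (simp add: Vector_Spaces.linear_iff)
  have "Vector_Spaces.linear scale scale (\<lambda>y. m' x y)" for x
    by (rule linearI; rule injD[OF f(2)])
      (simp_all add: hom f.add f.scale left[unfolded Vector_Spaces.linear_iff])
  moreover have "Vector_Spaces.linear scale scale (\<lambda>x. m' x y)" for y
    by (rule linearI; rule injD[OF f(2)])
      (simp_all add: hom f.add f.scale right[unfolded Vector_Spaces.linear_iff])
  ultimately show ?thesis by (simp add: bilinear_op_def)
qed

lemma (in bihom_assoc_dialgebra) bihom_assoc_dialgebra_pullback:
  assumes f: "Vector_Spaces.linear scale scale f" "inj f"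
    and alpha: "\<And>x. f (\<alpha> x) = \<alpha> (f x)"
    and beta: "\<And>x. f (\<beta> x) = \<beta> (f x)"
    and left: "\<And>x y. f (l' x y) = f x \<stileturn> f y"
    and right: "\<And>x y. f (r' x y) = f x \<turnstile> f y"
  shows "bihom_assoc_dialgebra scale l' r' \<alpha> \<beta>"
proof (intro bihom_assoc_dialgebra.intro bihom_assoc_dialgebra_axioms.intro)
  show "bilinear_op scale l'"
    by (rule bilinear_op_pullback[OF bilinear_left f]) (rule left)
  show "bilinear_op scale r'"
    by (rule bilinear_op_pullback[OF bilinear_right f]) (rule right)
  fix x y z
  show "l' (l' x y) (\<beta> z) = l' (\<alpha> x) (l' y z)"
    by (rule injD[OF f(2)]) (simp add: alpha beta left left_left)
  show "l' (l' x y) (\<beta> z) = l' (\<alpha> x) (r' y z)"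
    by (rule injD[OF f(2)]) (simp add: alpha beta left right left_left_right)
  show "l' (r' x y) (\<beta> z) = r' (\<alpha> x) (l' y z)"
    by (rule injD[OF f(2)]) (simp add: alpha beta left right right_left)
  show "r' (l' x y) (\<beta> z) = r' (\<alpha> x) (r' y z)"
    by (rule injD[OF f(2)]) (simp add: alpha beta left right left_right_right)
  show "r' (r' x y) (\<beta> z) = r' (\<alpha> x) (r' y z)"
    by (rule injD[OF f(2)]) (simp add: alpha beta right right_right)
qed (fact vector_space_axioms linear_alpha linear_beta alpha_beta_commute)+

theorem proposition2p24:
  fixes scale :: "'k::field \<Rightarrow> 'v::ab_group_add \<Rightarrow> 'v"
    and left_prod right_prod :: "'v \<Rightarrow> 'v \<Rightarrow> 'v"
    and \<alpha> \<beta> \<theta> :: "'v \<Rightarrow> 'v"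
    and k l :: nat
  assumes "bihom_assoc_dialgebra scale left_prod right_prod \<alpha> \<beta>"
    and "averaging_operator scale left_prod right_prod \<alpha> \<beta> k l \<theta>"
    and "inj \<theta>"
  shows "bihom_assoc_dialgebra scale
           (\<lambda>x y. left_prod (\<theta> x) (twist_pow \<alpha> \<beta> k l y))
           (\<lambda>x y. right_prod (twist_pow \<alpha> \<beta> k l x) (\<theta> y))
           \<alpha> \<beta>"
proof -
  interpret averaging_operator scale left_prod right_prod \<alpha> \<beta> k l \<theta> by (fact assms(2))
  show ?thesis
  proof (rule bihom_assoc_dialgebra_pullback[OF linear_theta assms(3)])
    show "\<theta> (\<alpha> x) = \<alpha> (\<theta> x)" "\<theta> (\<beta> x) = \<beta> (\<theta> x)" for x
      using alpha_theta_commute beta_theta_commute by (simp_all add: fun_eq_iff)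
  qed (fact averaging_left2[symmetric] averaging_right1[symmetric])+
qed

end
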